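(* For symmetric two-qubit states, let $r_{\mathrm{SAS}}$ be the maximal radius of a ball centred on $\rho_0=\tfrac13\mathbb 1_3$ containing only symmetric absolutely separable states, and let $R_{\mathrm{SAS}}$ be the minimal radius of a ball centred on $\rho_0$ that contains all symmetric absolutely separable states. Then $$r_{\mathrm{SAS}}=\frac{1}{2\sqrt6},\qquad R_{\mathrm{SAS}}=\frac{2}{3\sqrt6}.$$
   Context: Let $\mathcal H_1=\mathbb C^2$. The symmetric subspace $\mathcal H_1^{\vee 2}\subset\mathcal H_1\otimes\mathcal H_1$ is the 3-dimensional space of vectors invariant under exchange of the two qubits. A symmetric two-qubit state is a density operator on $\mathcal H_1\otimes\mathcal H_1$ supported on $\mathcal H_1^{\vee2}$, equivalently a density operator on $\mathcal H_1^{\vee2}\simeq\mathbb C^3$; $\rho_0=\frac13\mathbb 1_3$ is the maximally mixed state of the symmetric subspace. A state is separable if it is a convex combination of projectors onto product states. A symmetric state $\rho_S$ is symmetric absolutely separable (SAS) if $U_S\rho_SU_S^\dagger$ is separable for every $U_S\in SU(3)$, the special unitary group of $\mathcal H_1^{\vee 2}$. Balls are closed balls, within the set of symmetric states, for the Hilbert–Schmidt distance $\lVert\rho_S-\rho_0\rVert_{HS}=\sqrt{\mathrm{Tr}[\rho_S^2]-\frac13}$. *)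

theory Defs
  imports "HOL-Analysis.Analysis"
begin

definition cinner :: "complex^'n \<Rightarrow> complex^'n \<Rightarrow> complex" where
  "cinner u v = (\<Sum>i\<in>UNIV. cnj (u $ i) * v $ i)"

definition dagger :: "complex^'n^'m \<Rightarrow> complex^'m^'n" where
  "dagger A = (\<chi> i j. cnj (A $ j $ i))"

definition density_operator :: "complex^'n^'n \<Rightarrow> bool" where
  "density_operator \<rho> \<longleftrightarrow>
     dagger \<rho> = \<rho> \<and> (\<forall>v. 0 \<le> Re (cinner v (\<rho> *v v))) \<and> trace \<rho> = 1"

definition special_unitary :: "complex^'n^'n \<Rightarrow> bool" where
  "special_unitary U \<longleftrightarrow> dagger U ** U = mat 1 \<and> U ** dagger U = mat 1 \<and> det U = 1"

definition hs_norm :: "complex^'n^'n \<Rightarrow> real" where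
  "hs_norm A = sqrt (Re (trace (dagger A ** A)))"

text \<open>The two-qubit space is \<open>complex^(2 \<times> 2)\<close>. Indices are numbered from 1, as in the
  library, so the computational basis states are \<open>axis 1 1\<close> (for 0) and \<open>axis 2 1\<close> (for 1).\<close>

definition tensor :: "complex^2 \<Rightarrow> complex^2 \<Rightarrow> complex^(2 \<times> 2)" where
  "tensor u v = (\<chi> p. u $ fst p * v $ snd p)"

definition projector :: "complex^'n \<Rightarrow> complex^'n^'n" where
  "projector w = (\<chi> i j. w $ i * cnj (w $ j))"

definition separable :: "complex^(2 \<times> 2)^(2 \<times> 2) \<Rightarrow> bool" where
  "separable \<rho> \<longleftrightarrow>
     \<rho> \<in> convex hull {projector (tensor u v) | u v. norm u = 1 \<and> norm v = 1}"

definition symmetric_subspace :: "(complex^(2 \<times> 2)) set" where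
  "symmetric_subspace = {w. \<forall>i j. w $ (i, j) = w $ (j, i)}"

text \<open>The identification of \<open>complex^3\<close> with the symmetric subspace: the columns of this
  matrix are the orthonormal Dicke states 00, (01 + 10) / sqrt 2 and 11.\<close>

definition dicke :: "complex^3^(2 \<times> 2)" where
  "dicke = (\<chi> p k.
     if k = 1 then tensor (axis 1 1) (axis 1 1) $ p
     else if k = 2 then
       (tensor (axis 1 1) (axis 2 1) $ p + tensor (axis 2 1) (axis 1 1) $ p)
         / complex_of_real (sqrt 2)
     else tensor (axis 2 1) (axis 2 1) $ p)"

definition sym_embed :: "complex^3^3 \<Rightarrow> complex^(2 \<times> 2)^(2 \<times> 2)" where
  "sym_embed \<rho> = dicke ** \<rho> ** dagger dicke"

definition symmetric_states :: "(complex^3^3) set" where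
  "symmetric_states = {\<rho>. density_operator \<rho>}"

definition \<rho>\<^sub>0 :: "complex^3^3" where
  "\<rho>\<^sub>0 = (1 / 3) *\<^sub>R mat 1"

definition SAS :: "(complex^3^3) set" where
  "SAS = {\<rho> \<in> symmetric_states.
     \<forall>U. special_unitary U \<longrightarrow> separable (sym_embed (U ** \<rho> ** dagger U))}"

definition state_ball :: "real \<Rightarrow> (complex^3^3) set" where
  "state_ball r = {\<rho> \<in> symmetric_states. hs_norm (\<rho> - \<rho>\<^sub>0) \<le> r}"

definition is_r_SAS :: "real \<Rightarrow> bool" where
  "is_r_SAS r \<longleftrightarrow> 0 \<le> r \<and> state_ball r \<subseteq> SAS \<and>
     (\<forall>s\<ge>0. state_ball s \<subseteq> SAS \<longrightarrow> s \<le> r)"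

definition is_R_SAS :: "real \<Rightarrow> bool" where
  "is_R_SAS R \<longleftrightarrow> 0 \<le> R \<and> SAS \<subseteq> state_ball R \<and>
     (\<forall>s\<ge>0. SAS \<subseteq> state_ball s \<longrightarrow> R \<le> s)"


text \<open>Consistency of the conventions: the Dicke matrix is an isometry onto the symmetric
  subspace, embedding identifies density operators on \<open>complex^3\<close> with the two-qubit density
  operators supported on that subspace, and the Hilbert-Schmidt distance to the maximally
  mixed state is given by the purity.\<close>

lemma UNIV_2x2: "(UNIV :: (2 \<times> 2) set) = {(1,1), (1,2), (2,1), (2,2)}"
  using exhaust_2 by (auto simp: set_eq_iff)

lemma sum_2x2: "sum f (UNIV :: (2 \<times> 2) set) = f (1,1) + (f (1,2) + (f (2,1) + f (2,2)))"
  by (simp add: UNIV_2x2)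

lemma dagger_dagger [simp]: "dagger (dagger A) = A"
  by (simp add: dagger_def vec_eq_iff)

lemma dagger_mult: "dagger (A ** B) = dagger B ** dagger A"
  by (simp add: dagger_def matrix_matrix_mult_def vec_eq_iff mult.commute)

lemma cinner_dagger: "cinner v (A *v w) = cinner (dagger A *v v) w"
proof -
  have "cinner v (A *v w) = (\<Sum>i\<in>UNIV. \<Sum>j\<in>UNIV. cnj (v $ i) * (A $ i $ j * w $ j))"
    by (simp add: cinner_def matrix_vector_mult_def sum_distrib_left)
  also have "\<dots> = (\<Sum>j\<in>UNIV. \<Sum>i\<in>UNIV. cnj (v $ i) * (A $ i $ j * w $ j))"
    by (rule sum.swap)
  also have "\<dots> = cinner (dagger A *v v) w"
    by (simp add: cinner_def matrix_vector_mult_def dagger_def sum_distrib_left sum_distrib_right mult_ac)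
  finally show ?thesis .
qed

lemma hs_norm_eq_norm: "hs_norm A = norm A"
proof -
  have "Re (trace (dagger A ** A)) = (\<Sum>i\<in>UNIV. \<Sum>j\<in>UNIV. (norm (A $ j $ i))\<^sup>2)"
    by (simp add: trace_def dagger_def matrix_matrix_mult_def cmod_power2 flip: power2_eq_square)
  also have "\<dots> = (\<Sum>j\<in>UNIV. \<Sum>i\<in>UNIV. (norm (A $ j $ i))\<^sup>2)"
    by (rule sum.swap)
  also have "\<dots> = (norm A)\<^sup>2"
    by (simp add: norm_vec_def L2_set_def sum_nonneg)
  finally show ?thesis
    by (simp add: hs_norm_def)
qed

lemma hs_norm_purity:
  assumes "\<rho> \<in> symmetric_states"
  shows "hs_norm (\<rho> - \<rho>\<^sub>0) = sqrt (Re (trace (\<rho> ** \<rho>)) - 1 / 3)"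
proof -
  have h: "dagger \<rho> = \<rho>" and t: "trace \<rho> = 1"
    using assms by (auto simp: symmetric_states_def density_operator_def)
  have d: "dagger (\<rho> - \<rho>\<^sub>0) = \<rho> - \<rho>\<^sub>0"
    using h by (auto simp: dagger_def \<rho>\<^sub>0_def vec_eq_iff mat_def)
  have sq: "(\<rho> - \<rho>\<^sub>0) ** (\<rho> - \<rho>\<^sub>0) = \<rho> ** \<rho> - (2 / 3) *\<^sub>R \<rho> + (1 / 9) *\<^sub>R mat 1"
    by (simp add: vec_eq_iff forall_3 matrix_matrix_mult_def sum_3 \<rho>\<^sub>0_def mat_def
        scaleR_conv_of_real[where 'a=complex] algebra_simps)
  have "trace ((\<rho> - \<rho>\<^sub>0) ** (\<rho> - \<rho>\<^sub>0)) = trace (\<rho> ** \<rho>) - (2 / 3) * trace \<rho> + 1 / 3"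
    by (simp add: sq trace_def sum_3 mat_def scaleR_conv_of_real[where 'a=complex] algebra_simps)
  then have "Re (trace ((\<rho> - \<rho>\<^sub>0) ** (\<rho> - \<rho>\<^sub>0))) = Re (trace (\<rho> ** \<rho>)) - 1 / 3"
    by (simp add: t)
  then show ?thesis
    by (simp add: hs_norm_def d)
qed

lemma sqrt2_mult: "complex_of_real (sqrt 2) * complex_of_real (sqrt 2) = 2"
  by (metis abs_numeral of_real_mult of_real_numeral real_sqrt_mult_self)

lemma dicke_isometry: "dagger dicke ** dicke = mat 1"
  by (simp add: vec_eq_iff forall_3 matrix_matrix_mult_def sum_2x2 dagger_def dicke_def
      tensor_def axis_def mat_def sqrt2_mult)

lemma dicke_projection:
  assumes "w \<in> symmetric_subspace"
  shows "dicke *v (dagger dicke *v w) = w"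
proof -
  have s: "w $ (2,1) = w $ (1,2)"
    using assms by (simp add: symmetric_subspace_def)
  show ?thesis
    by (simp add: vec_eq_iff forall_2 matrix_vector_mult_def sum_2x2 sum_3 dagger_def
        dicke_def tensor_def axis_def s sqrt2_mult
        flip: add_divide_distrib)
qed

lemma range_dicke: "range ((*v) dicke) = symmetric_subspace"
proof
  show "range ((*v) dicke) \<subseteq> symmetric_subspace"
    by (auto simp: forall_2 matrix_vector_mult_def sum_3
      dicke_def tensor_def axis_def symmetric_subspace_def)
  show "symmetric_subspace \<subseteq> range ((*v) dicke)"
    using dicke_projection by (metis rangeI subsetI)
qed

lemma bij_betw_sym_embed:
  "bij_betw sym_embed symmetric_states
     {\<sigma>. density_operator \<sigma> \<and> range ((*v) \<sigma>) \<subseteq> symmetric_subspace}"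
  (is "bij_betw _ _ ?S")
proof (rule bij_betw_byWitness[where f' = "\<lambda>\<sigma>. dagger dicke ** \<sigma> ** dicke"])
  have inv: "dagger dicke ** sym_embed \<rho> ** dicke = \<rho>" for \<rho>
  proof -
    have "dagger dicke ** sym_embed \<rho> ** dicke
        = (dagger dicke ** dicke) ** \<rho> ** (dagger dicke ** dicke)"
      by (simp add: sym_embed_def matrix_mul_assoc)
    then show ?thesis
      by (simp add: dicke_isometry)
  qed
  show "\<forall>\<rho>\<in>symmetric_states. dagger dicke ** sym_embed \<rho> ** dicke = \<rho>"
    by (simp add: inv)
  have left: "dicke ** dagger dicke ** \<sigma> = \<sigma>" if "\<sigma> \<in> ?S" for \<sigma>
  proof -
    have "dicke *v (dagger dicke *v (\<sigma> *v x)) = \<sigma> *v x" for x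
      using that by (intro dicke_projection) auto
    then show ?thesis
      by (simp add: matrix_eq matrix_vector_mul_assoc matrix_mul_assoc)
  qed
  have right: "\<sigma> ** (dicke ** dagger dicke) = \<sigma>" if "\<sigma> \<in> ?S" for \<sigma>
    using arg_cong[OF left[OF that], of dagger] that
    by (simp add: dagger_mult density_operator_def)
  have ret: "sym_embed (dagger dicke ** \<sigma> ** dicke) = \<sigma>" if "\<sigma> \<in> ?S" for \<sigma>
    using left[OF that] right[OF that] by (simp add: sym_embed_def matrix_mul_assoc)
  then show "\<forall>\<sigma>\<in>?S. sym_embed (dagger dicke ** \<sigma> ** dicke) = \<sigma>"
    by blast
  have tr: "trace (sym_embed \<rho>) = trace \<rho>" for \<rho>
  proof -
    have "trace (sym_embed \<rho>) = trace (dagger dicke ** (dicke ** \<rho>))"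
      unfolding sym_embed_def by (rule trace_mul_sym)
    then show ?thesis
      by (simp add: matrix_mul_assoc dicke_isometry)
  qed
  have rng: "range ((*v) (sym_embed \<rho>)) \<subseteq> symmetric_subspace" for \<rho>
    unfolding range_dicke[symmetric] sym_embed_def
    by (auto simp flip: matrix_vector_mul_assoc)
  have pos1: "cinner v (sym_embed \<rho> *v v) = cinner (dagger dicke *v v) (\<rho> *v (dagger dicke *v v))"
    for v \<rho>
    by (simp add: sym_embed_def cinner_dagger[of v dicke, symmetric] matrix_vector_mul_assoc
        matrix_mul_assoc)
  have pos2: "cinner v ((dagger dicke ** \<sigma> ** dicke) *v v) = cinner (dicke *v v) (\<sigma> *v (dicke *v v))"
    for v \<sigma>
    using cinner_dagger[of v "dagger dicke" "\<sigma> *v (dicke *v v)"]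
    by (simp add: matrix_vector_mul_assoc matrix_mul_assoc)
  show "sym_embed ` symmetric_states \<subseteq> ?S"
  proof (rule image_subsetI)
    fix \<rho> assume "\<rho> \<in> symmetric_states"
    then have "density_operator (sym_embed \<rho>)"
      by (simp add: symmetric_states_def density_operator_def tr pos1)
        (simp add: sym_embed_def dagger_mult matrix_mul_assoc)
    with rng show "sym_embed \<rho> \<in> ?S"
      by blast
  qed
  show "(\<lambda>\<sigma>. dagger dicke ** \<sigma> ** dicke) ` ?S \<subseteq> symmetric_states"
  proof (intro image_subsetI)
    fix \<sigma> assume s: "\<sigma> \<in> ?S"
    have "trace (dagger dicke ** \<sigma> ** dicke) = trace \<sigma>"
      using tr[of "dagger dicke ** \<sigma> ** dicke"] ret[OF s] by simp
    then show "dagger dicke ** \<sigma> ** dicke \<in> symmetric_states"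
      using s by (simp add: symmetric_states_def density_operator_def pos2)
        (simp add: dagger_mult matrix_mul_assoc)
  qed
qed

end

theory Submission
  imports Defs
begin

text \<open>
  A symmetric two-qubit state is a quadratic expression \<open>\<Sum> M\<^sub>i\<^sub>j B\<^sub>i \<otimes> B\<^sub>j\<close> in a basis of the Hermitian
  \<open>2 \<times> 2\<close> matrices, with a real symmetric \<open>M\<close> that is orthogonal to the determinant form. If
  \<open>M\<close> is positive semidefinite, then it is a sum of squares of vectors, and rotating pairs of vectors
  of opposite sign makes every vector null for the determinant; null vectors are rank-one matrices,
  so the state is separable. Positivity of \<open>M\<close> says that \<open>\<rho>\<close> has nonnegative expectation on every
  \<open>X \<otimes> X\<close> with \<open>X\<close> Hermitian. If \<open>X\<close> has eigenvalues \<open>\<mu>, \<nu>\<close>, then \<open>X \<otimes> X\<close> has eigenvalues \<open>\<mu>\<^sup>2, \<mu>\<nu>, \<nu>\<^sup>2\<close>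
  on the symmetric subspace; with \<open>t = \<mu>\<^sup>2 + \<mu>\<nu> + \<nu>\<^sup>2\<close> its squared norm is at most \<open>3 t\<^sup>2\<close>, whence the inner
  radius by Cauchy-Schwarz, and its operator norm is at most \<open>4 t / 3\<close>, whence the states with spectrum
  \<open>(4/9, 4/9, 1/9)\<close> are separable. Conversely, diagonalising a symmetric absolutely separable state with
  its largest eigenvalue on the middle Dicke state, the partial transpose gives \<open>\<lambda>\<^sub>1\<^sup>2 \<le> 4 \<lambda>\<^sub>2 \<lambda>\<^sub>3\<close>, which
  bounds the purity by \<open>11/27\<close>.
\<close>

section \<open>Rank-one decompositions with null vectors\<close>

definition outer :: "real^'n \<Rightarrow> real^'n^'n" where
  "outer x = (\<chi> i j. x $ i * x $ j)"

lemma outer_nth [simp]: "outer x $ i $ j = x $ i * x $ j"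
  by (simp add: outer_def)

text \<open>On \<open>t *\<^sub>R axis i 1 + axis j 1\<close> the form is affine in \<open>t\<close>
  with slope \<open>2 * M $ i $ j\<close>. An affine function that is nonnegative on the whole line
  has slope 0.\<close>

lemma psd_zero_diagonal:
  fixes M :: "real^'n^'n"
  assumes sym: "transpose M = M" and psd: "\<And>x. 0 \<le> x \<bullet> (M *v x)" and z: "M $ i $ i = 0"
  shows "M $ i $ j = 0"
proof (rule ccontr)
  assume n: "M $ i $ j \<noteq> 0"
  have s: "M $ j $ i = M $ i $ j"
    using sym by (metis transpose_def vec_lambda_beta)
  have "0 \<le> 2 * t * (M $ i $ j) + M $ j $ j" for t
  proof -
    let ?x = "t *\<^sub>R axis i 1 + axis j 1 :: real^'n"
    have "?x \<bullet> (M *v ?x) = t * t * M $ i $ i + 2 * t * (M $ i $ j) + M $ j $ j"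
      by (simp add: matrix_vector_right_distrib matrix_vector_mult_scaleR inner_add_left inner_add_right
        matrix_vector_mult_basis inner_axis' column_def s algebra_simps)
    then show ?thesis using psd[of ?x] z by simp
  qed
  \<comment> \<open>This \<open>t\<close> brings the linear term down to
    \<open>- (\<bar>M $ j $ j\<bar> + 1)\<close>, so the sum is negative.\<close>
  moreover have "2 * (- (\<bar>M $ j $ j\<bar> + 1) / (2 * M $ i $ j)) * M $ i $ j = - (\<bar>M $ j $ j\<bar> + 1)"
    using n by (simp add: divide_simps)
  ultimately show False by (smt (verit))
qed

text \<open>One step of symmetric Gaussian elimination. The form of \<open>N\<close> at
  \<open>x\<close> is the minimum of the form of \<open>M\<close> on the line through
  \<open>x\<close> in direction \<open>axis k 1\<close>, which gives its positivity.\<close>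

lemma psd_eliminate:
  fixes M :: "real^'n^'n"
  assumes sym: "transpose M = M" and psd: "\<And>x. 0 \<le> x \<bullet> (M *v x)" and k: "M $ k $ k > 0"
  defines "N \<equiv> M - outer ((1 / sqrt (M $ k $ k)) *\<^sub>R M $ k)"
  shows "transpose N = N" "0 \<le> x \<bullet> (N *v x)" "N $ k $ k = 0"
    "M $ i $ i = 0 \<Longrightarrow> N $ i $ i = 0"
proof -
  have s: "M $ j $ i = M $ i $ j" for i j
    using sym by (metis transpose_def vec_lambda_beta)
  have N: "N $ i $ j = M $ i $ j - M $ k $ i * M $ k $ j / M $ k $ k" for i j
    using k by (simp add: N_def)
  show "transpose N = N"
    by (simp add: vec_eq_iff transpose_def N) (metis s mult.commute)
  show "N $ k $ k = 0" using k by (simp add: N)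
  let ?r = "M $ k"
  \<comment> \<open>The minimiser on that line, found by completing the square.\<close>
  let ?t = "(?r \<bullet> x) / M $ k $ k"
  let ?y = "x - ?t *\<^sub>R axis k 1"
  have Mk: "M *v axis k 1 = ?r"
    by (simp add: matrix_vector_mult_basis vec_eq_iff column_def s)
  have kM: "(M *v x) $ k = ?r \<bullet> x"
    by (simp add: matrix_vector_mult_def inner_vec_def[of "M $ k"])
  have "?y \<bullet> (M *v ?y) = x \<bullet> (M *v x) - (?r \<bullet> x)\<^sup>2 / M $ k $ k"
    using k by (simp add: matrix_vector_mult_diff_distrib matrix_vector_mult_scaleR inner_diff_left
        inner_diff_right Mk kM inner_axis' inner_commute[of x ?r] power2_eq_square)
  also have "\<dots> = x \<bullet> (N *v x)"
  proof -
    have "outer ((1 / sqrt (M $ k $ k)) *\<^sub>R ?r) *v x = ?t *\<^sub>R ?r"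
      using k by (simp add: vec_eq_iff matrix_vector_mult_def inner_vec_def sum_distrib_left
        sum_divide_distrib sum_distrib_right mult_ac)
    then show ?thesis
      by (simp add: N_def matrix_vector_mult_diff_rdistrib inner_diff_right inner_commute[of x ?r] power2_eq_square)
  qed
  finally show psdN: "0 \<le> x \<bullet> (N *v x)" using psd[of ?y] by simp
  show "N $ i $ i = 0" if "M $ i $ i = 0"
    using psd_zero_diagonal[OF sym psd that, of k] s[of k i] that by (simp add: N)
qed

text \<open>Cholesky elimination, by induction on the number of nonzero diagonal entries: each step
  clears one and creates none. Once the diagonal vanishes, so does the matrix.\<close>

lemma psd_sum_outer:
  fixes M :: "real^'n^'n"
  assumes "transpose M = M" and "\<And>x. 0 \<le> x \<bullet> (M *v x)"
  shows "\<exists>xs. M = (\<Sum>x\<leftarrow>xs. outer x)"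
  using assms
proof (induction "card {i. M $ i $ i \<noteq> 0}" arbitrary: M rule: less_induct)
  case less
  show ?case
  proof (cases "\<exists>k. M $ k $ k \<noteq> 0")
    case False
    then have "M = (\<Sum>x\<leftarrow>[]. outer x)"
      using psd_zero_diagonal[OF less.prems] by (simp add: vec_eq_iff)
    then show ?thesis by blast
  next
    case True
    then obtain k where nz: "M $ k $ k \<noteq> 0" by blast
    have "axis k 1 \<bullet> (M *v axis k 1) = M $ k $ k"
      by (simp add: matrix_vector_mult_basis inner_axis' column_def)
    with less.prems(2)[of "axis k 1"] nz have k: "M $ k $ k > 0" by simp
    let ?z = "(1 / sqrt (M $ k $ k)) *\<^sub>R M $ k"
    note e = psd_eliminate[OF less.prems k]
    have "{i. (M - outer ?z) $ i $ i \<noteq> 0} \<subset> {i. M $ i $ i \<noteq> 0}"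
      using e(3,4) nz by blast
    then have "card {i. (M - outer ?z) $ i $ i \<noteq> 0} < card {i. M $ i $ i \<noteq> 0}"
      by (simp add: psubset_card_mono)
    from less.hyps[OF this e(1,2)] obtain xs where "M - outer ?z = (\<Sum>x\<leftarrow>xs. outer x)" by blast
    then have "M = (\<Sum>x\<leftarrow>?z # xs. outer x)" by (simp add: algebra_simps)
    then show ?thesis by blast
  qed
qed

section \<open>Rotating pairs of vectors to null vectors\<close>

lemma outer_rotate:
  assumes "c\<^sup>2 + s\<^sup>2 = 1"
  shows "outer (c *\<^sub>R x + s *\<^sub>R y) + outer (c *\<^sub>R y - s *\<^sub>R x) = outer x + outer y"
proof -
  have "(c * a + s * b) * (c * a' + s * b') + (c * b - s * a) * (c * b' - s * a')
     = (c\<^sup>2 + s\<^sup>2) * (a * a' + b * b')" for a b a' b'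
    by algebra
  with assms show ?thesis by (simp add: vec_eq_iff)
qed

text \<open>Intermediate value theorem in the rotation angle: the form is positive at angle 0 and
  negative at \<open>pi/2\<close>.\<close>

lemma ex_null_rotation:
  fixes J :: "real^'n^'n"
  assumes "0 < J \<bullet> outer x" "J \<bullet> outer y < 0"
  shows "\<exists>c s. c\<^sup>2 + s\<^sup>2 = 1 \<and> J \<bullet> outer (c *\<^sub>R x + s *\<^sub>R y) = 0"
proof -
  let ?f = "\<lambda>t. J \<bullet> outer (cos t *\<^sub>R x + sin t *\<^sub>R y)"
  have "continuous_on {0..pi/2} ?f"
    unfolding inner_vec_def outer_nth vector_add_component vector_scaleR_component
    by (auto intro!: continuous_intros)
  then have "\<exists>t\<ge>0. t \<le> pi/2 \<and> ?f t = 0"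
    using assms by (intro IVT2') auto
  then show ?thesis by (metis sin_cos_squared_add2 add.commute)
qed

lemma sum_list_all_zero_or_signs:
  fixes f :: "'a \<Rightarrow> real"
  assumes "(\<Sum>x\<leftarrow>xs. f x) = 0"
  shows "(\<forall>x\<in>set xs. f x = 0) \<or> (\<exists>x\<in>set xs. \<exists>y\<in>set xs. 0 < f x \<and> f y < 0)"
proof -
  have pos: "(\<forall>x\<in>set xs. g x = 0)" if "\<forall>x\<in>set xs. 0 \<le> g x" "(\<Sum>x\<leftarrow>xs. g x) = 0" for g :: "'a \<Rightarrow> real"
    using that sum_list_nonneg_eq_0_iff[of "map g xs"] by auto
  have "(\<Sum>x\<leftarrow>xs. - f x) = 0" using assms uminus_sum_list_map[of f xs] by (simp add: o_def)
  then show ?thesis using pos[of f] pos[of "\<lambda>x. - f x"] assms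
    by (meson neg_0_le_iff_le neg_equal_0_iff_equal not_le)
qed

text \<open>Rotating a pair of opposite signs splits off one null vector \<open>z\<close>. It
  contributes 0, so the shorter list with \<open>w\<close> in place of the pair still has total
  0.\<close>

lemma sum_outer_null:
  fixes J :: "real^'n^'n"
  assumes "J \<bullet> (\<Sum>x\<leftarrow>xs. outer x) = 0"
  shows "\<exists>ys. (\<forall>y\<in>set ys. J \<bullet> outer y = 0) \<and> (\<Sum>y\<leftarrow>ys. outer y) = (\<Sum>x\<leftarrow>xs. outer x)"
  using assms
proof (induction "length xs" arbitrary: xs rule: less_induct)
  case less
  have "J \<bullet> (\<Sum>x\<leftarrow>zs. outer x) = (\<Sum>x\<leftarrow>zs. J \<bullet> outer x)" for zs
    by (induction zs) (auto simp: inner_add_right)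
  then consider "\<forall>x\<in>set xs. J \<bullet> outer x = 0"
    | x y where "x \<in> set xs" "y \<in> set xs" "0 < J \<bullet> outer x" "J \<bullet> outer y < 0"
    using sum_list_all_zero_or_signs[of "\<lambda>x. J \<bullet> outer x" xs] less.prems by auto
  then show ?case
  proof cases
    case 1
    then show ?thesis by blast
  next
    case 2
    obtain c s where cs: "c\<^sup>2 + s\<^sup>2 = 1" and null: "J \<bullet> outer (c *\<^sub>R x + s *\<^sub>R y) = 0"
      using ex_null_rotation 2 by blast
    define z where "z = c *\<^sub>R x + s *\<^sub>R y"
    define w where "w = c *\<^sub>R y - s *\<^sub>R x"
    have rot: "outer z + outer w = outer x + outer y"
      unfolding z_def w_def by (rule outer_rotate[OF cs])
    let ?zs = "remove1 y (remove1 x xs)"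
    \<comment> \<open>The opposite signs force \<open>x\<close> and \<open>y\<close> to differ, so
      \<open>y\<close> survives the removal of \<open>x\<close>.\<close>
    have y: "y \<in> set (remove1 x xs)" using 2 by (metis in_set_remove1 less_asym)
    have "(\<Sum>x\<leftarrow>xs. outer x) = outer x + (outer y + (\<Sum>x\<leftarrow>?zs. outer x))"
      by (simp add: sum_list_map_remove1[OF 2(1)] sum_list_map_remove1[OF y])
    then have eq: "(\<Sum>x\<leftarrow>xs. outer x) = outer z + (\<Sum>x\<leftarrow>w # ?zs. outer x)"
      using rot by (simp add: algebra_simps)
    have len: "length (w # ?zs) < length xs"
      using length_pos_if_in_set[OF 2(1)] length_pos_if_in_set[OF y] length_remove1[of x xs]
        length_remove1[of y "remove1 x xs"] 2(1) y by simp
    have "J \<bullet> (\<Sum>x\<leftarrow>w # ?zs. outer x) = 0"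
      using less.prems null unfolding eq z_def[symmetric] by (simp add: inner_add_right)
    from less.hyps[OF len this] obtain ys where
      "\<forall>y\<in>set ys. J \<bullet> outer y = 0" "(\<Sum>y\<leftarrow>ys. outer y) = (\<Sum>x\<leftarrow>w # ?zs. outer x)" by blast
    then show ?thesis using null eq z_def by (intro exI[of _ "z # ys"]) auto
  qed
qed

section \<open>Diagonalisation by special unitaries\<close>

lemma cinner_add_left: "cinner (u + v) w = cinner u w + cinner v w"
  and cinner_add_right: "cinner w (u + v) = cinner w u + cinner w v"
  by (simp_all add: cinner_def sum.distrib algebra_simps)

lemma cinner_scale_left: "cinner (z *s u) w = cnj z * cinner u w"
  and cinner_scale_right: "cinner w (z *s u) = z * cinner w u"
  by (simp_all add: cinner_def sum_distrib_left mult_ac)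

lemma cinner_commute: "cinner u v = cnj (cinner v u)"
  by (simp add: cinner_def mult.commute)

lemma cinner_self: "cinner v v = complex_of_real ((norm v)\<^sup>2)"
  by (simp add: cinner_def norm_vec_def L2_set_def sum_nonneg mult.commute flip: complex_norm_square)

text \<open>Divide by \<open>s\<close> and let it tend to 0. This is the first-order condition at a
  maximum of the Rayleigh form.\<close>

lemma real_quadratic_nonneg_imp_zero:
  fixes z :: real
  assumes "\<And>s. s > 0 \<Longrightarrow> 2 * s * z \<le> s\<^sup>2 * K" and "z \<ge> 0"
  shows "z = 0"
proof (rule ccontr)
  assume "z \<noteq> 0"
  with assms(2) have z: "z > 0" by simp
  let ?s = "z / (\<bar>K\<bar> + 1)"
  have s: "?s > 0" using z by simp
  have "?s * (2 * z) \<le> ?s * (?s * K)"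
    using assms(1)[OF s] by (simp only: power2_eq_square mult_ac)
  then have "2 * z \<le> ?s * K" using s by (rule mult_left_le_imp_le)
  also have "\<dots> \<le> ?s * (\<bar>K\<bar> + 1)" using s by (intro mult_left_mono) auto
  also have "\<dots> = z" by simp
  finally show False using z by simp
qed

section \<open>The Rayleigh form and its maximisers\<close>

definition rayleigh :: "complex^'n^'n \<Rightarrow> complex^'n \<Rightarrow> real" where
  "rayleigh A v = Re (cinner v (A *v v))"

lemma rayleigh_scale: "rayleigh A (z *s v) = (cmod z)\<^sup>2 * rayleigh A v"
proof -
  have "cinner (z *s v) (A *v (z *s v)) = complex_of_real ((cmod z)\<^sup>2) * cinner v (A *v v)"
    unfolding complex_norm_square
    by (simp add: vector_scalar_commute cinner_scale_left cinner_scale_right)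
  then show ?thesis by (simp add: rayleigh_def)
qed

lemma norm_scale: "norm (z *s v) = cmod z * norm (v :: complex^'n)"
  by (simp add: norm_vec_def norm_mult L2_set_right_distrib)

lemma rayleigh_bound:
  assumes max: "\<And>v. norm v = 1 \<Longrightarrow> cinner u v = 0 \<Longrightarrow> rayleigh A v \<le> m" and "cinner u v = 0"
  shows "rayleigh A v \<le> m * (norm v)\<^sup>2"
proof (cases "v = 0")
  case True
  then show ?thesis by (simp add: rayleigh_def cinner_def)
next
  case False
  let ?w = "complex_of_real (1 / norm v) *s v"
  have "norm ?w = 1" "cinner u ?w = 0"
    using False assms(2) by (simp_all only: norm_scale cinner_scale_right) (simp_all add: norm_divide)
  from max[OF this] have "(1 / norm v)\<^sup>2 * rayleigh A v \<le> m"
    unfolding rayleigh_scale by (simp only: norm_of_real power2_abs)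
  then show ?thesis using False by (simp add: field_simps)
qed

text \<open>Compactness of the set of unit vectors orthogonal to \<open>u\<close>. The choice
  \<open>u = 0\<close> lifts the constraint, so the lemma serves both stages of the
  diagonalisation.\<close>

lemma rayleigh_maximizer:
  fixes A :: "complex^'n^'n"
  assumes "\<exists>v. norm v = 1 \<and> cinner u v = 0"
  obtains e where "norm e = 1" "cinner u e = 0"
    "\<And>v. norm v = 1 \<Longrightarrow> cinner u v = 0 \<Longrightarrow> rayleigh A v \<le> rayleigh A e"
proof -
  let ?S = "{v. norm v = 1 \<and> cinner u v = 0}"
  have c: "continuous_on T (cinner u)" "continuous_on T (rayleigh A)" for T
    unfolding cinner_def rayleigh_def matrix_vector_mult_def
    by (auto intro!: continuous_intros)
  have "closed ?S"
    unfolding Collect_conj_eq by (intro closed_Int closed_Collect_eq continuous_intros c)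
  moreover have "bounded ?S" by (auto simp: bounded_iff)
  ultimately have "compact ?S" by (simp add: compact_eq_bounded_closed)
  from continuous_attains_sup[OF this _ c(2)] assms obtain e where
    "e \<in> ?S" "\<forall>v\<in>?S. rayleigh A v \<le> rayleigh A e" by blast
  then show ?thesis using that by blast
qed

text \<open>Moving \<open>e\<close> in an admissible direction \<open>w\<close> cannot increase the
  Rayleigh quotient, so the first-order term, a multiple of \<open>cinner w (A *v e)\<close>,
  vanishes.\<close>

lemma rayleigh_maximizer_orthogonal:
  fixes A :: "complex^'n^'n"
  assumes herm: "dagger A = A" and e: "norm e = 1" "cinner u e = 0"
    and max: "\<And>v. norm v = 1 \<Longrightarrow> cinner u v = 0 \<Longrightarrow> rayleigh A v \<le> rayleigh A e"
    and w: "cinner u w = 0" "cinner e w = 0"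
  shows "cinner w (A *v e) = 0"
proof -
  define z where "z = cinner w (A *v e)"
  have "2 * s * (cmod z)\<^sup>2 \<le> s\<^sup>2 * ((cmod z)\<^sup>2 * (rayleigh A e * (norm w)\<^sup>2 - rayleigh A w))" for s
  proof -
    \<comment> \<open>The factor \<open>z\<close> aligns the phase, so that the first-order term is
      the real number \<open>2 * s * (cmod z)\<^sup>2\<close>.\<close>
    define t where "t = complex_of_real s * z"
    let ?v = "e + t *s w"
    have ew: "cinner e (A *v w) = cnj z"
      using cinner_dagger[of e A w] by (simp add: herm z_def cinner_commute[of "A *v e" w])
    have we: "cinner w e = 0" using w(2) cinner_commute[of w e] by simp
    have "complex_of_real ((norm ?v)\<^sup>2) = complex_of_real (1 + (cmod t)\<^sup>2 * (norm w)\<^sup>2)"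
      unfolding cinner_self[symmetric] cinner_add_left cinner_add_right cinner_scale_left cinner_scale_right
      by (simp add: w we) (simp add: cinner_self e mult.assoc[symmetric] flip: complex_norm_square)
    then have nv: "(norm ?v)\<^sup>2 = 1 + (cmod t)\<^sup>2 * (norm w)\<^sup>2" by (simp only: of_real_eq_iff)
    have "cinner ?v (A *v ?v) = cinner e (A *v e) + t * cnj z + cnj t * z + cinner (t *s w) (A *v (t *s w))"
      by (simp add: matrix_vector_right_distrib vector_scalar_commute cinner_add_left cinner_add_right cinner_scale_left
          cinner_scale_right ew z_def distrib_left)
    then have "rayleigh A ?v = rayleigh A e + 2 * Re (cnj t * z) + rayleigh A (t *s w)"
      by (simp add: rayleigh_def algebra_simps)
    moreover have "Re (cnj t * z) = s * (cmod z)\<^sup>2"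
      by (simp add: t_def cmod_power2) (simp add: algebra_simps power2_eq_square)
    ultimately have rv: "rayleigh A ?v = rayleigh A e + 2 * s * (cmod z)\<^sup>2 + (cmod t)\<^sup>2 * rayleigh A w"
      by (simp add: rayleigh_scale)
    have "rayleigh A ?v \<le> rayleigh A e * (norm ?v)\<^sup>2"
      by (rule rayleigh_bound[where u = u], rule max)
        (simp_all add: cinner_add_right cinner_scale_right e w)
    moreover have "(cmod t)\<^sup>2 = s\<^sup>2 * (cmod z)\<^sup>2" by (simp add: t_def norm_mult power_mult_distrib)
    ultimately show ?thesis unfolding rv nv by (simp add: algebra_simps)
  qed
  then have "(cmod z)\<^sup>2 = 0" by (intro real_quadratic_nonneg_imp_zero) auto
  then show ?thesis by (simp add: z_def)
qed

section \<open>Conjugate cross product and completion to a special unitary\<close>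

definition ccross :: "complex^3 \<Rightarrow> complex^3 \<Rightarrow> complex^3" where
  "ccross u v = vector [cnj (u $ 2 * v $ 3 - u $ 3 * v $ 2), cnj (u $ 3 * v $ 1 - u $ 1 * v $ 3),
     cnj (u $ 1 * v $ 2 - u $ 2 * v $ 1)]"

lemma cinner_ccross [simp]: "cinner u (ccross u v) = 0" "cinner v (ccross u v) = 0"
  by (simp_all add: cinner_def ccross_def sum_3 algebra_simps)

text \<open>Lagrange's identity for the Hermitian inner product.\<close>

lemma norm_ccross:
  assumes "norm u = 1" "norm v = 1" "cinner u v = 0"
  shows "norm (ccross u v) = 1"
proof -
  have "cinner (ccross u v) (ccross u v) = cinner u u * cinner v v - cinner u v * cinner v u"
    by (simp add: cinner_def ccross_def sum_3 algebra_simps)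
  also have "\<dots> = 1" by (simp add: assms cinner_self)
  finally have "complex_of_real ((norm (ccross u v))\<^sup>2) = complex_of_real 1" unfolding cinner_self by simp
  then have "(norm (ccross u v))\<^sup>2 = 1" by (simp only: of_real_eq_iff)
  then show ?thesis by (simp add: power2_eq_1_iff) (smt (verit) norm_ge_zero)
qed

text \<open>The choice of the third row makes the determinant 1.\<close>

definition bra_matrix :: "complex^3 \<Rightarrow> complex^3 \<Rightarrow> complex^3^3" where
  "bra_matrix u v = (\<chi> i j. cnj ((vector [u, v, ccross u v] :: complex^3^3) $ i $ j))"

lemma bra_matrix_conj:
  "(bra_matrix u v ** A ** dagger (bra_matrix u v)) $ i $ j =
    cinner ((vector [u, v, ccross u v] :: complex^3^3) $ i) (A *v ((vector [u, v, ccross u v] :: complex^3^3) $ j))"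
  by (simp add: bra_matrix_def dagger_def matrix_matrix_mult_def cinner_def matrix_vector_mult_def sum_3 algebra_simps)

lemma special_unitary_bra_matrix:
  assumes "norm u = 1" "norm v = 1" "cinner u v = 0"
  shows "special_unitary (bra_matrix u v)"
proof -
  let ?U = "bra_matrix u v"
  have [simp]: "cinner v u = 0" "cinner (ccross u v) u = 0" "cinner (ccross u v) v = 0"
    using assms(3) by (simp_all add: cinner_commute[of v u] cinner_commute[of "ccross u v"])
  have "?U ** mat 1 ** dagger ?U = mat 1"
    by (simp only: vec_eq_iff bra_matrix_conj forall_3)
      (simp add: assms cinner_self norm_ccross, simp add: mat_def)
  then have 1: "?U ** dagger ?U = mat 1" by simp
  \<comment> \<open>Expansion along the third row, whose cofactors are the entries of
    \<open>ccross u v\<close>.\<close>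
  have "det ?U = cinner (ccross u v) (ccross u v)"
    by (simp add: det_3 bra_matrix_def cinner_def sum_3 ccross_def algebra_simps)
  then have "det ?U = 1" by (simp add: cinner_self norm_ccross assms)
  then show ?thesis using 1 matrix_left_right_inverse[of ?U "dagger ?U"] by (simp add: special_unitary_def)
qed

text \<open>Maximise the Rayleigh form on the unit sphere, then on the orthogonal complement of the
  maximiser; the cross product completes the eigenbasis. The largest eigenvalue goes to position 2,
  the middle Dicke state, where it enters the partial transpose inequality squared.\<close>

lemma hermitian_diagonalization:
  fixes A :: "complex^3^3"
  assumes herm: "dagger A = A"
  obtains U D where "special_unitary U" "D = U ** A ** dagger U"
    "\<And>i j. i \<noteq> j \<Longrightarrow> D $ i $ j = 0"
    "Re (D $ 3 $ 3) \<le> Re (D $ 1 $ 1)" "Re (D $ 1 $ 1) \<le> Re (D $ 2 $ 2)"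
proof -
  have "\<exists>v::complex^3. norm v = 1 \<and> cinner 0 v = 0"
    by (rule exI[of _ "axis 1 1"]) (simp add: cinner_def)
  then obtain e1 :: "complex^3" where e1: "norm e1 = 1" "cinner 0 e1 = 0"
    and max1: "\<And>v. norm v = 1 \<Longrightarrow> cinner 0 v = 0 \<Longrightarrow> rayleigh A v \<le> rayleigh A e1"
    by (rule rayleigh_maximizer) blast
  have "\<exists>v. norm v = 1 \<and> cinner e1 v = 0"
  proof -
    \<comment> \<open>A basis vector that is not parallel to \<open>e1\<close>.\<close>
    let ?a = "if e1 $ 1 = 0 \<and> e1 $ 2 = 0 then axis 1 1 else axis 3 1 :: complex^3"
    have "ccross e1 ?a \<noteq> 0"
    proof
      assume "ccross e1 ?a = 0"
      then have "e1 = 0 "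
        by (auto simp: ccross_def vec_eq_iff forall_3 axis_def split: if_splits)
      then show False using e1 by simp
    qed
    let ?c = "ccross e1 ?a"
    have "norm (complex_of_real (1 / norm ?c) *s ?c) = 1"
      using \<open>?c \<noteq> 0\<close> unfolding norm_scale norm_of_real by simp
    moreover have "cinner e1 (complex_of_real (1 / norm ?c) *s ?c) = 0"
      by (simp only: cinner_scale_right) simp
    ultimately show ?thesis by blast
  qed
  then obtain e2 where e2: "norm e2 = 1" "cinner e1 e2 = 0"
    and max2: "\<And>v. norm v = 1 \<Longrightarrow> cinner e1 v = 0 \<Longrightarrow> rayleigh A v \<le> rayleigh A e2"
    by (rule rayleigh_maximizer) blast
  let ?f = "ccross e2 e1"
  have e21: "cinner e2 e1 = 0" using e2(2) by (simp add: cinner_commute[of e2])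
  have f: "norm ?f = 1" by (simp add: norm_ccross e1 e2 e21)
  have z: "cinner 0 w = 0" for w :: "complex^3" by (simp add: cinner_def)
  have o1: "cinner w (A *v e1) = 0" if "cinner e1 w = 0" for w
    using rayleigh_maximizer_orthogonal[OF herm e1 max1 z that] .
  have o2: "cinner w (A *v e2) = 0" if "cinner e1 w = 0" "cinner e2 w = 0" for w
    using rayleigh_maximizer_orthogonal[OF herm e2 max2 that] .
  have swap: "cinner v (A *v w) = cnj (cinner w (A *v v))" for v w
    using cinner_dagger[of v A w] by (simp add: herm cinner_commute[of "A *v v" w])
  have offs: "cinner e2 (A *v e1) = 0" "cinner ?f (A *v e1) = 0" "cinner ?f (A *v e2) = 0"
    by (simp_all add: o1 o2 e2)
  have offs': "cinner e1 (A *v e2) = 0" "cinner e1 (A *v ?f) = 0" "cinner e2 (A *v ?f) = 0"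
    using offs by (simp_all add: swap[of e1 e2] swap[of e1 ?f] swap[of e2 ?f])
  \<comment> \<open>The overall maximiser \<open>e1\<close> is the second row, which gives the
    required order of the diagonal.\<close>
  let ?U = "bra_matrix e2 e1"
  show ?thesis
  proof
    show "special_unitary ?U" by (intro special_unitary_bra_matrix e1 e2 e21)
    show "?U ** A ** dagger ?U = ?U ** A ** dagger ?U" by simp
    show "(?U ** A ** dagger ?U) $ i $ j = 0" if "i \<noteq> j" for i j
      using that exhaust_3[of i] exhaust_3[of j] offs offs' by (auto simp: bra_matrix_conj)
    show "Re ((?U ** A ** dagger ?U) $ 3 $ 3) \<le> Re ((?U ** A ** dagger ?U) $ 1 $ 1)"
      using max2[OF f] by (simp add: bra_matrix_conj rayleigh_def)
    show "Re ((?U ** A ** dagger ?U) $ 1 $ 1) \<le> Re ((?U ** A ** dagger ?U) $ 2 $ 2)"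
      using max1[OF e2(1) z] by (simp add: bra_matrix_conj rayleigh_def)
  qed
qed

section \<open>A sufficient condition for separability\<close>

lemma vector_4 [simp]:
  "(vector [w, x, y, z] :: 'a::zero^4) $ 1 = w"
  "(vector [w, x, y, z] :: 'a::zero^4) $ 2 = x"
  "(vector [w, x, y, z] :: 'a::zero^4) $ 3 = y"
  "(vector [w, x, y, z] :: 'a::zero^4) $ 4 = z"
  unfolding vector_def by simp_all

definition herm :: "real^4 \<Rightarrow> complex^2^2" where
  "herm x = vector [vector [of_real (x $ 1), Complex (x $ 3) (x $ 4)],
                    vector [Complex (x $ 3) (- x $ 4), of_real (x $ 2)]]"

text \<open>The tensor square \<open>X \<otimes> X\<close> of \<open>X = herm x\<close>.\<close>

definition herm_square :: "real^4 \<Rightarrow> complex^(2 \<times> 2)^(2 \<times> 2)" where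
  "herm_square x = (\<chi> p q. herm x $ fst p $ fst q * herm x $ snd p $ snd q)"

definition herm_bilinear :: "real^4^4 \<Rightarrow> complex^(2 \<times> 2)^(2 \<times> 2)" where
  "herm_bilinear M = (\<chi> p q. \<Sum>i\<in>UNIV. \<Sum>j\<in>UNIV. of_real (M $ i $ j) *
     (herm (axis i 1) $ fst p $ fst q * herm (axis j 1) $ snd p $ snd q))"

lemma herm_bilinear_outer: "herm_bilinear (outer x) = herm_square x"
  by (simp add: vec_eq_iff split_paired_All forall_2 herm_bilinear_def herm_square_def herm_def
      sum_4 axis_def complex_eq_iff algebra_simps)

lemma herm_bilinear_sum_list: "herm_bilinear (\<Sum>x\<leftarrow>xs. outer x) = (\<Sum>x\<leftarrow>xs. herm_square x)"
proof (induction xs)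
  case Nil
  then show ?case by (simp add: herm_bilinear_def vec_eq_iff)
next
  case (Cons x xs)
  have "herm_bilinear (A + B) = herm_bilinear A + herm_bilinear B" for A B
    by (simp add: herm_bilinear_def vec_eq_iff sum.distrib distrib_right)
  with Cons show ?case by (simp add: herm_bilinear_outer)
qed

text \<open>The matrix \<open>M\<close> for which the embedded state is \<open>\<Sum>\<^sub>i\<^sub>j M\<^sub>i\<^sub>j B\<^sub>i \<otimes> B\<^sub>j\<close>, where
  \<open>B\<^sub>i = herm (axis i 1)\<close>. It is a real form of the partial transpose.\<close>

definition state_coords :: "complex^3^3 \<Rightarrow> real^4^4" where
  "state_coords \<rho> = vector [
     vector [Re (\<rho>$1$1), Re (\<rho>$2$2) / 2, Re (\<rho>$1$2) / sqrt 2, Im (\<rho>$1$2) / sqrt 2],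
     vector [Re (\<rho>$2$2) / 2, Re (\<rho>$3$3), Re (\<rho>$2$3) / sqrt 2, Im (\<rho>$2$3) / sqrt 2],
     vector [Re (\<rho>$1$2) / sqrt 2, Re (\<rho>$2$3) / sqrt 2, Re (\<rho>$2$2) / 4 + Re (\<rho>$1$3) / 2, Im (\<rho>$1$3) / 2],
     vector [Im (\<rho>$1$2) / sqrt 2, Im (\<rho>$2$3) / sqrt 2, Im (\<rho>$1$3) / 2, Re (\<rho>$2$2) / 4 - Re (\<rho>$1$3) / 2]]"

lemma hermitian_entries:
  assumes "dagger \<rho> = \<rho>"
  shows "\<rho> $ j $ i = cnj (\<rho> $ i $ j)" "Im (\<rho> $ i $ i) = 0"
proof -
  have 1: "\<rho> $ j $ i = cnj (\<rho> $ i $ j)" for i j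
    using arg_cong[OF assms, of "\<lambda>A. A $ j $ i"] by (simp add: dagger_def)
  then show "\<rho> $ j $ i = cnj (\<rho> $ i $ j)" .
  show "Im (\<rho> $ i $ i) = 0" using 1[of i i] by (simp add: complex_eq_iff)
qed

lemma herm_bilinear_state_coords:
  fixes \<rho> :: "complex^3^3"
  assumes "dagger \<rho> = \<rho>"
  shows "herm_bilinear (state_coords \<rho>) = sym_embed \<rho>"
proof -
  note h = hermitian_entries[OF assms]
  have e: "\<rho>$2$1 = cnj (\<rho>$1$2)" "\<rho>$3$1 = cnj (\<rho>$1$3)" "\<rho>$3$2 = cnj (\<rho>$2$3)"
    "Im (\<rho>$1$1) = 0" "Im (\<rho>$2$2) = 0" "Im (\<rho>$3$3) = 0"
    by (rule h)+
  show ?thesis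
    by (simp add: vec_eq_iff split_paired_All forall_2 herm_bilinear_def sym_embed_def herm_def
      state_coords_def matrix_matrix_mult_def sum_3 sum_2x2 sum_4 axis_def dagger_def dicke_def tensor_def
      complex_eq_iff e)
qed

text \<open>The compression to the symmetric subspace of \<open>X \<otimes> X\<close> for the Hermitian matrix \<open>X\<close> with
  diagonal \<open>a, b\<close> and upper off-diagonal entry \<open>h\<close>.\<close>

definition sym_square :: "real \<Rightarrow> real \<Rightarrow> complex \<Rightarrow> complex^3^3" where
  "sym_square a b h = vector [
     vector [of_real (a\<^sup>2), of_real (sqrt 2 * a) * h, h\<^sup>2],
     vector [of_real (sqrt 2 * a) * cnj h, of_real (a * b + (cmod h)\<^sup>2), of_real (sqrt 2 * b) * h],
     vector [(cnj h)\<^sup>2, of_real (sqrt 2 * b) * cnj h, of_real (b\<^sup>2)]]"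

text \<open>Let \<open>X\<close> have diagonal \<open>x $ 1, x $ 2\<close> and upper entry
  \<open>h = Complex (x $ 3 / 2) (x $ 4 / 2)\<close>. Its traces against the basis matrices are the
  coordinates of \<open>x\<close>; the last two are \<open>2 * Re h\<close> and
  \<open>2 * Im h\<close>, whence the halves.\<close>

lemma state_coords_quadratic_form:
  fixes \<rho> :: "complex^3^3"
  assumes "dagger \<rho> = \<rho>"
  shows "x \<bullet> (state_coords \<rho> *v x)
    = sym_square (x $ 1) (x $ 2) (Complex (x $ 3 / 2) (x $ 4 / 2)) \<bullet> \<rho>"
proof -
  note h = hermitian_entries[OF assms]
  have e: "\<rho>$2$1 = cnj (\<rho>$1$2)" "\<rho>$3$1 = cnj (\<rho>$1$3)" "\<rho>$3$2 = cnj (\<rho>$2$3)"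
    "Im (\<rho>$1$1) = 0" "Im (\<rho>$2$2) = 0" "Im (\<rho>$3$3) = 0"
    by (rule h)+
  have s: "z / sqrt 2 = sqrt 2 * z / 2" for z :: real
    by (simp add: field_simps)
  have cm: "cmod (Complex p q) * cmod (Complex p q) = p * p + q * q" for p q
    using cmod_power2[of "Complex p q"] by (simp add: power2_eq_square)
  show ?thesis
    by (simp add: inner_vec_def matrix_vector_mult_def sum_3 sum_4 state_coords_def sym_square_def
       inner_complex_def e s cmod_power2 Re_power2 power2_eq_square)
      (simp only: cm, simp add: field_simps)
qed

text \<open>Paired with \<open>outer x\<close> this is the determinant of \<open>herm x\<close>. A
  single entry carries the product \<open>x $ 1 * x $ 2\<close>, which suffices for pairing with
  symmetric matrices.\<close>

definition det_form :: "real^4^4" where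
  "det_form = vector [vector [0, 1, 0, 0], vector [0, 0, 0, 0], vector [0, 0, -1, 0], vector [0, 0, 0, -1]]"

text \<open>This expresses that the entries \<open>((1,2),(1,2))\<close> and \<open>((1,2),(2,1))\<close> of a symmetric state agree.\<close>

lemma det_form_state_coords: "det_form \<bullet> state_coords \<rho> = 0"
  by (simp add: inner_vec_def sum_4 det_form_def state_coords_def)

lemma det_form_outer: "det_form \<bullet> outer x = x $ 1 * x $ 2 - (x $ 3)\<^sup>2 - (x $ 4)\<^sup>2"
  by (simp add: inner_vec_def sum_4 det_form_def power2_eq_square)

text \<open>A singular Hermitian \<open>2 \<times> 2\<close> matrix is plus or minus a rank-one
  projector up to scale, and the sign disappears in the tensor square.\<close>

lemma null_herm_square:
  assumes "det_form \<bullet> outer x = 0"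
  shows "\<exists>v. herm_square x = projector (tensor v v)"
proof -
  have q: "x $ 1 * x $ 2 = (x $ 3)\<^sup>2 + (x $ 4)\<^sup>2" using assms by (simp add: det_form_outer)
  have "\<exists>v s. (s::complex) * s = 1 \<and> (\<forall>i k. v $ i * cnj (v $ k) = s * herm x $ i $ k)"
  proof (cases "x $ 1 = 0")
    case True
    with q have "x $ 3 = 0" "x $ 4 = 0" by (simp_all add: sum_power2_eq_zero_iff)
    define v :: "complex^2" where "v = vector [0, of_real (sqrt \<bar>x $ 2\<bar>)]"
    define s :: complex where "s = of_real (if x $ 2 < 0 then -1 else 1)"
    have "\<forall>i k. v $ i * cnj (v $ k) = s * herm x $ i $ k"
      using True \<open>x $ 3 = 0\<close> \<open>x $ 4 = 0\<close>
      by (simp add: forall_2 v_def s_def herm_def complex_eq_iff flip: of_real_mult)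
    moreover have "s * s = 1" by (simp add: s_def)
    ultimately show ?thesis by blast
  next
    case False
    define r where "r = sqrt \<bar>x $ 1\<bar>"
    have r: "r * r = \<bar>x $ 1\<bar>" "r \<noteq> 0" using False by (auto simp: r_def)
    \<comment> \<open>The first column of \<open>herm x\<close>, divided by the root of
      \<open>\<bar>x $ 1\<bar>\<close>.\<close>
    define v :: "complex^2" where "v = vector [of_real (x $ 1 / r), Complex (x $ 3 / r) (- (x $ 4 / r))]"
    have rr: "x $ 1 / r * (y / r) = sgn (x $ 1) * y" for y
      using r False by (simp add: sgn_if field_simps split: if_splits)
    have "(x $ 3 / r) * (x $ 3 / r) + (x $ 4 / r) * (x $ 4 / r) = (x $ 1 * x $ 2) / (r * r)"
      using q by (simp add: power2_eq_square add_divide_distrib)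
    also have "\<dots> = sgn (x $ 1) * x $ 2"
      unfolding r by (simp add: sgn_if)
    finally have 22: "(x $ 3 / r) * (x $ 3 / r) + (x $ 4 / r) * (x $ 4 / r) = sgn (x $ 1) * x $ 2" .
    have "\<forall>i k. v $ i * cnj (v $ k) = of_real (sgn (x $ 1)) * herm x $ i $ k"
      using rr[of "x $ 1"] rr[of "x $ 3"] rr[of "x $ 4"] 22
      by (simp add: forall_2 v_def herm_def complex_eq_iff mult.commute)
    moreover have "complex_of_real (sgn (x $ 1)) * of_real (sgn (x $ 1)) = 1"
      using False by (simp add: sgn_if)
    ultimately show ?thesis by blast
  qed
  then obtain v and s :: complex where s: "s * s = 1"
    and v: "\<And>i k. v $ i * cnj (v $ k) = s * herm x $ i $ k" by blast
  have "herm x $ i $ k * herm x $ j $ l = v $ i * v $ j * cnj (v $ k * v $ l)" for i j k l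
  proof -
    have "v $ i * v $ j * cnj (v $ k * v $ l) = (v $ i * cnj (v $ k)) * (v $ j * cnj (v $ l))" by simp
    also have "\<dots> = (s * s) * (herm x $ i $ k * herm x $ j $ l)" unfolding v by simp
    finally show ?thesis by (simp add: s)
  qed
  then have "herm_square x = projector (tensor v v)"
    by (simp add: vec_eq_iff herm_square_def projector_def tensor_def)
  then show ?thesis ..
qed

section \<open>From sums of projectors to convex combinations\<close>

lemma norm_tensor: "norm (tensor u v) = norm u * norm v"
proof -
  have "(norm (tensor u v))\<^sup>2 = (norm u * norm v)\<^sup>2"
    by (simp add: norm_vec_def L2_set_def sum_nonneg sum_2x2 sum_2 tensor_def norm_mult power_mult_distrib algebra_simps)
  then show ?thesis by simp
qed

lemma trace_projector: "trace (projector w) = of_real ((norm w)\<^sup>2)"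
  by (simp add: trace_def projector_def norm_vec_def L2_set_def sum_nonneg flip: complex_norm_square)

lemma projector_tensor_scaled:
  "\<exists>u. norm u = 1 \<and> projector (tensor v v) = (norm (tensor v v))\<^sup>2 *\<^sub>R projector (tensor u u)"
proof (cases "v = 0")
  case True
  \<comment> \<open>The weight is 0, so an arbitrary unit vector serves.\<close>
  then have "projector (tensor v v) = (norm (tensor v v))\<^sup>2 *\<^sub>R projector (tensor (axis 1 1) (axis 1 1))"
    by (simp add: projector_def tensor_def vec_eq_iff norm_tensor)
  moreover have "norm (axis 1 1 :: complex^2) = 1" by simp
  ultimately show ?thesis by blast
next
  case False
  then have "projector (tensor v v)
      = (norm (tensor v v))\<^sup>2 *\<^sub>R projector (tensor ((1 / norm v) *\<^sub>R v) ((1 / norm v) *\<^sub>R v))"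
    unfolding norm_tensor
    by (simp add: projector_def tensor_def vec_eq_iff power2_eq_square scaleR_conv_of_real[where 'a=complex])
  moreover have "norm ((1 / norm v) *\<^sub>R v) = 1" using False by simp
  ultimately show ?thesis by blast
qed

text \<open>The squared norms are the convex weights, and the trace condition makes them sum to 1.
  Indexing by positions allows repeated vectors.\<close>

lemma separable_if_sum_projectors:
  assumes "\<sigma> = (\<Sum>v\<leftarrow>vs. projector (tensor v v))" and "trace \<sigma> = 1"
  shows "separable \<sigma>"
proof -
  let ?n = "length vs"
  let ?t = "\<lambda>i. (norm (tensor (vs ! i) (vs ! i)))\<^sup>2"
  obtain f where f: "\<And>v. norm (f v) = 1"
      "\<And>v. projector (tensor v v) = (norm (tensor v v))\<^sup>2 *\<^sub>R projector (tensor (f v) (f v))"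
    using projector_tensor_scaled by metis
  have \<sigma>: "\<sigma> = (\<Sum>i=0..<?n. projector (tensor (vs ! i) (vs ! i)))"
    using assms(1) by (simp add: sum_list_sum_nth)
  have "trace \<sigma> = (\<Sum>i=0..<?n. trace (projector (tensor (vs ! i) (vs ! i))))"
    unfolding \<sigma> trace_def sum_component by (rule sum.swap)
  also have "\<dots> = of_real (\<Sum>i=0..<?n. ?t i)"
    by (simp add: trace_projector)
  finally have "complex_of_real (\<Sum>i=0..<?n. ?t i) = complex_of_real 1"
    using assms(2) by simp
  then have t: "(\<Sum>i=0..<?n. ?t i) = 1" by (simp only: of_real_eq_iff)
  let ?S = "{projector (tensor u v) | u v. norm u = 1 \<and> norm v = 1}"
  have "(\<Sum>i=0..<?n. ?t i *\<^sub>R projector (tensor (f (vs ! i)) (f (vs ! i)))) \<in> convex hull ?S"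
    by (intro convex_sum t convex_convex_hull) (auto intro!: hull_inc f(1))
  then show ?thesis
    unfolding separable_def \<sigma> f(2)[symmetric] .
qed

lemma trace_sym_embed: "trace (sym_embed \<rho>) = trace \<rho>"
proof -
  have "trace (sym_embed \<rho>) = trace (dagger dicke ** (dicke ** \<rho>))"
    unfolding sym_embed_def by (rule trace_mul_sym)
  then show ?thesis by (simp add: matrix_mul_assoc dicke_isometry)
qed

text \<open>The hypothesis \<open>pos\<close> is positive semidefiniteness of
  \<open>state_coords \<rho>\<close>. Its decomposition into vectors null for
  \<open>det_form\<close> writes the embedded state as a sum of unnormalised projectors onto
  \<open>v \<otimes> v\<close>.\<close>

theorem separable_sym_embedI:
  assumes dens: "density_operator \<rho>" and pos: "\<And>a b h. 0 \<le> sym_square a b h \<bullet> \<rho>"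
  shows "separable (sym_embed \<rho>)"
proof -
  have herm: "dagger \<rho> = \<rho>" and tr: "trace \<rho> = 1" using dens by (auto simp: density_operator_def)
  have "transpose (state_coords \<rho>) = state_coords \<rho>"
    by (simp add: vec_eq_iff forall_4 transpose_def state_coords_def)
  from psd_sum_outer[OF this] pos obtain xs where xs: "state_coords \<rho> = (\<Sum>x\<leftarrow>xs. outer x)"
    by (auto simp: state_coords_quadratic_form[OF herm])
  from sum_outer_null[of det_form xs] det_form_state_coords[of \<rho>] obtain ys where
    ys: "\<forall>y\<in>set ys. det_form \<bullet> outer y = 0" "(\<Sum>y\<leftarrow>ys. outer y) = state_coords \<rho>" by (auto simp: xs)
  obtain f where f: "\<And>y. det_form \<bullet> outer y = 0 \<Longrightarrow> herm_square y = projector (tensor (f y) (f y))"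
    using null_herm_square by metis
  have "sym_embed \<rho> = (\<Sum>y\<leftarrow>ys. herm_square y)"
    using herm_bilinear_sum_list[of ys] by (simp add: ys herm_bilinear_state_coords[OF herm])
  also have "\<dots> = (\<Sum>y\<leftarrow>ys. projector (tensor (f y) (f y)))"
    using ys(1) f by (metis (mono_tags, lifting) map_eq_conv)
  finally have "sym_embed \<rho> = (\<Sum>v\<leftarrow>map f ys. projector (tensor v v))" by (simp add: o_def)
  then show ?thesis by (rule separable_if_sum_projectors) (simp add: trace_sym_embed tr)
qed

section \<open>The two radii\<close>

lemma sym_square_trace_nonneg: "0 \<le> a\<^sup>2 + a * b + b\<^sup>2 + (cmod h)\<^sup>2"
proof -
  have "2 * (a\<^sup>2 + a * b + b\<^sup>2 + (cmod h)\<^sup>2) = a\<^sup>2 + b\<^sup>2 + (a + b)\<^sup>2 + 2 * (cmod h)\<^sup>2"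
    by algebra
  also have "\<dots> \<ge> 0" by simp
  finally show ?thesis by simp
qed

lemma sym_square_inner_mat: "sym_square a b h \<bullet> mat 1 = a\<^sup>2 + a * b + b\<^sup>2 + (cmod h)\<^sup>2"
  by (simp add: inner_vec_def sum_3 sym_square_def mat_def inner_complex_def Re_power2 Im_power2 flip: of_real_power)

text \<open>In the eigenvalues of \<open>X\<close> both sides are
  \<open>\<mu>^4 + \<mu>^2 \<nu>^2 + \<nu>^4\<close>. The subtracted term contains the squared trace
  of \<open>X\<close>, so the bound \<open>3 * t\<^sup>2\<close> is attained at traceless
  \<open>X\<close>.\<close>

lemma sym_square_inner_self:
  fixes a b h
  defines "t \<equiv> a\<^sup>2 + a * b + b\<^sup>2 + (cmod h)\<^sup>2"
  shows "sym_square a b h \<bullet> sym_square a b h = 3 * t\<^sup>2 - 2 * t * (a + b)\<^sup>2"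
proof -
  show ?thesis
    unfolding t_def cmod_power2
    by (simp add: inner_vec_def sum_3 sym_square_def inner_complex_def Re_power2 Im_power2 cmod_power2
        flip: of_real_power) algebra
qed

lemma density_inner_mat:
  assumes "density_operator \<rho>"
  shows "mat 1 \<bullet> (\<rho> - \<rho>\<^sub>0) = 0"
proof -
  have "mat 1 \<bullet> A = Re (trace A)" for A :: "complex^3^3"
    by (simp add: inner_vec_def sum_3 mat_def trace_def inner_complex_def)
  moreover have "trace (\<rho> - \<rho>\<^sub>0) = trace \<rho> - 1"
    by (simp add: trace_def sum_3 \<rho>\<^sub>0_def mat_def scaleR_conv_of_real[where 'a=complex])
  ultimately show ?thesis using assms by (simp add: density_operator_def)
qed

text \<open>Cauchy-Schwarz between the traceless part \<open>?H\<close> and the deviation from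
  \<open>\<rho>\<^sub>0\<close>. The norm of \<open>?H\<close> is at most
  \<open>sqrt (8/3) * t\<close>, and the radius is chosen so that the product is
  \<open>t / 3\<close>, the expectation in \<open>\<rho>\<^sub>0\<close>.\<close>

lemma separable_in_ball:
  assumes dens: "density_operator \<rho>" and r: "norm (\<rho> - \<rho>\<^sub>0) \<le> 1 / (2 * sqrt 6)"
  shows "separable (sym_embed \<rho>)"
proof (rule separable_sym_embedI[OF dens])
  fix a b h
  define t where "t = a\<^sup>2 + a * b + b\<^sup>2 + (cmod h)\<^sup>2"
  have t: "t \<ge> 0" unfolding t_def by (rule sym_square_trace_nonneg)
  let ?G = "sym_square a b h"
  let ?H = "?G - (t / 3) *\<^sub>R mat 1"
  have m: "?G \<bullet> mat 1 = t" by (simp add: sym_square_inner_mat t_def)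
  have mm: "(mat 1 :: complex^3^3) \<bullet> mat 1 = 3"
    by (simp add: inner_vec_def sum_3 mat_def inner_complex_def)
  have "(norm ?H)\<^sup>2 = ?G \<bullet> ?G - t\<^sup>2 / 3"
    using m unfolding power2_norm_eq_inner
    by (simp add: inner_diff_left inner_diff_right inner_commute[of "mat 1" ?G] mm power2_eq_square)
  also have "\<dots> \<le> 8 / 3 * t\<^sup>2"
    using t by (simp add: sym_square_inner_self flip: t_def)
  also have "\<dots> = (2 * sqrt 6 / 3 * t)\<^sup>2"
    by (simp add: power_mult_distrib power_divide)
  finally have H: "norm ?H \<le> 2 * sqrt 6 / 3 * t"
    by (rule power2_le_imp_le) (use t in simp)
  have "\<bar>?H \<bullet> (\<rho> - \<rho>\<^sub>0)\<bar> \<le> norm ?H * norm (\<rho> - \<rho>\<^sub>0)"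
    by (rule Cauchy_Schwarz_ineq2)
  also have "\<dots> \<le> (2 * sqrt 6 / 3 * t) * (1 / (2 * sqrt 6))"
    using H r t by (intro mult_mono) auto
  also have "\<dots> = t / 3" by simp
  finally have "\<bar>?H \<bullet> (\<rho> - \<rho>\<^sub>0)\<bar> \<le> t / 3" .
  moreover have "?G \<bullet> \<rho> = t / 3 + ?H \<bullet> (\<rho> - \<rho>\<^sub>0)"
  proof -
    have "?H \<bullet> (\<rho> - \<rho>\<^sub>0) = ?G \<bullet> (\<rho> - \<rho>\<^sub>0)"
      by (simp only: inner_diff_left[of ?G] inner_scaleR_left density_inner_mat[OF dens])
    then show ?thesis by (simp add: \<rho>\<^sub>0_def inner_diff_right m)
  qed
  ultimately show "0 \<le> ?G \<bullet> \<rho>" by linarith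
qed

text \<open>With \<open>X\<close> as above and \<open>w\<close> the symmetric \<open>2 \<times> 2\<close> matrix of \<open>\<psi>\<close>, the left-hand side is
  \<open>\<langle>X w, (X w)\<^sup>T\<rangle>\<close>; the sum of squares in the proof combines \<open>\<parallel>X w - (X w)\<^sup>T\<parallel>\<^sup>2 \<ge> 0\<close> with
  \<open>(2 tr X - X)\<^sup>2 = 4 (tr X)\<^sup>2 - 4 det X - 3 X\<^sup>2\<close>.\<close>

lemma sym_square_le:
  fixes \<psi> :: "complex^3"
  shows "sym_square a b h \<bullet> projector \<psi> \<le> 4 / 3 * (a\<^sup>2 + a * b + b\<^sup>2 + (cmod h)\<^sup>2) * (norm \<psi>)\<^sup>2"
proof -
  \<comment> \<open>The symmetric matrix of \<open>\<psi>\<close> has diagonal \<open>p, r\<close>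
    and off-diagonal entry \<open>z\<close>; the root of 2 normalises the middle Dicke
    state.\<close>
  define p r z where "p = \<psi> $ 1" and "r = \<psi> $ 3" and "z = \<psi> $ 2 / of_real (sqrt 2)"
  have \<psi>: "\<psi> $ 1 = p" "\<psi> $ 3 = r" "\<psi> $ 2 = of_real (sqrt 2) * z"
    by (simp_all add: p_def r_def z_def)
  have two: "sqrt 2 * (sqrt 2 * x) = 2 * x" for x :: real by simp
  have G: "sym_square a b h \<bullet> projector \<psi> = a\<^sup>2 * (cmod p)\<^sup>2 + 2 * (a * b + (cmod h)\<^sup>2) * (cmod z)\<^sup>2
      + b\<^sup>2 * (cmod r)\<^sup>2 + 4 * a * Re (h * z * cnj p) + 2 * Re (h\<^sup>2 * r * cnj p) + 4 * b * Re (h * r * cnj z)"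
    unfolding cmod_power2
    by (simp add: inner_vec_def sum_3 sym_square_def projector_def \<psi> inner_complex_def Re_power2 Im_power2 cmod_power2
        flip: of_real_power) (simp add: algebra_simps two power2_eq_square)
  have n: "(norm \<psi>)\<^sup>2 = (cmod p)\<^sup>2 + 2 * (cmod z)\<^sup>2 + (cmod r)\<^sup>2"
    by (simp add: norm_vec_def L2_set_def sum_nonneg sum_3 \<psi> norm_mult power_mult_distrib)
  have "4 * (a\<^sup>2 + a * b + b\<^sup>2 + (cmod h)\<^sup>2) * (norm \<psi>)\<^sup>2 - 3 * (sym_square a b h \<bullet> projector \<psi>)
    = 3 * (cmod (a * z + h * r - (cnj h * p + b * z)))\<^sup>2
      + (cmod ((a + 2 * b) * p - h * z))\<^sup>2 + (cmod ((a + 2 * b) * z - h * r))\<^sup>2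
      + (cmod ((2 * a + b) * z - cnj h * p))\<^sup>2 + (cmod ((2 * a + b) * r - cnj h * z))\<^sup>2"
    unfolding n G cmod_power2 by (simp add: Re_power2 Im_power2) algebra
  also have "\<dots> \<ge> 0" by (intro add_nonneg_nonneg) auto
  finally show ?thesis by simp
qed

section \<open>Unitary invariance of states, purity and distance\<close>

lemma norm_unitary:
  assumes "dagger U ** U = mat 1"
  shows "norm (U *v v) = norm v"
proof -
  have "cinner (U *v v) (U *v v) = cinner v v"
    using assms by (simp add: cinner_dagger[of "U *v v" U v] matrix_vector_mul_assoc)
  then have "(norm (U *v v))\<^sup>2 = (norm v)\<^sup>2"
    unfolding cinner_self by (simp only: of_real_eq_iff)
  then show ?thesis by simp
qed

lemma projector_unitary: "U ** projector v ** dagger U = projector (U *v v)"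
  by (simp add: vec_eq_iff projector_def dagger_def matrix_matrix_mult_def matrix_vector_mult_def
     sum_distrib_left sum_distrib_right mult_ac)

lemma density_operator_unitary:
  assumes U: "dagger U ** U = mat 1" and d: "density_operator \<rho>"
  shows "density_operator (U ** \<rho> ** dagger U)"
proof -
  have "trace (U ** \<rho> ** dagger U) = trace (dagger U ** (U ** \<rho>))" by (rule trace_mul_sym)
  then have "trace (U ** \<rho> ** dagger U) = trace \<rho>" by (simp add: matrix_mul_assoc U)
  moreover have "cinner v ((U ** \<rho> ** dagger U) *v v) = cinner (dagger U *v v) (\<rho> *v (dagger U *v v))" for v
    by (simp add: cinner_dagger[of v U, symmetric] matrix_vector_mul_assoc matrix_mul_assoc)
  moreover have "dagger (U ** \<rho> ** dagger U) = U ** dagger \<rho> ** dagger U"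
    by (simp add: dagger_mult matrix_mul_assoc)
  ultimately show ?thesis using d by (simp add: density_operator_def)
qed

lemma trace_square_unitary:
  assumes U: "dagger U ** U = mat 1"
  shows "trace ((U ** \<rho> ** dagger U) ** (U ** \<rho> ** dagger U)) = trace (\<rho> ** \<rho>)"
proof -
  have "(U ** \<rho> ** dagger U) ** (U ** \<rho> ** dagger U) = U ** \<rho> ** (dagger U ** U) ** \<rho> ** dagger U"
    by (simp only: matrix_mul_assoc)
  also have "\<dots> = U ** (\<rho> ** \<rho>) ** dagger U" by (simp add: U matrix_mul_assoc)
  also have "trace \<dots> = trace (dagger U ** (U ** (\<rho> ** \<rho>)))" by (rule trace_mul_sym)
  finally show ?thesis by (simp add: matrix_mul_assoc U)
qed

lemma hs_norm_unitary:
  assumes U: "dagger U ** U = mat 1" and d: "density_operator \<rho>"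
  shows "hs_norm (U ** \<rho> ** dagger U - \<rho>\<^sub>0) = hs_norm (\<rho> - \<rho>\<^sub>0)"
  using density_operator_unitary[OF assms] d
  by (simp add: hs_norm_purity symmetric_states_def trace_square_unitary[OF U])

section \<open>Diagonal states and the extremal one\<close>

definition diag3 :: "real \<Rightarrow> real \<Rightarrow> real \<Rightarrow> complex^3^3" where
  "diag3 x y z = (\<chi> i j. if i = j then of_real (vector [x, y, z] $ i) else 0)"

lemma diag3_state:
  assumes "0 \<le> x" "0 \<le> y" "0 \<le> z" "x + y + z = 1"
  shows "diag3 x y z \<in> symmetric_states"
    and "hs_norm (diag3 x y z - \<rho>\<^sub>0) = sqrt (x\<^sup>2 + y\<^sup>2 + z\<^sup>2 - 1 / 3)"
proof -
  have 1: "dagger (diag3 x y z) = diag3 x y z"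
    by (simp add: dagger_def diag3_def vec_eq_iff)
  have 2: "trace (diag3 x y z) = 1"
    using assms(4) by (simp add: trace_def diag3_def sum_3 flip: of_real_add)
  have "Re (cinner v (diag3 x y z *v v)) = x * (cmod (v $ 1))\<^sup>2 + y * (cmod (v $ 2))\<^sup>2 + z * (cmod (v $ 3))\<^sup>2" for v
    by (simp add: cinner_def matrix_vector_mult_def sum_3 diag3_def cmod_power2)
      (simp add: algebra_simps power2_eq_square)
  then show s: "diag3 x y z \<in> symmetric_states"
    using 1 2 assms(1-3) by (simp add: symmetric_states_def density_operator_def)
  show "hs_norm (diag3 x y z - \<rho>\<^sub>0) = sqrt (x\<^sup>2 + y\<^sup>2 + z\<^sup>2 - 1 / 3)"
    unfolding hs_norm_purity[OF s] by (simp add: trace_def matrix_matrix_mult_def sum_3 diag3_def power2_eq_square)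
qed

text \<open>Every unitary conjugate is \<open>4/9\<close> of the identity minus \<open>1/3\<close>
  of a rank-one projector. By \<open>sym_square_le\<close> its expectation on
  \<open>X \<otimes> X\<close> is at least \<open>(4/9 - 1/3 * 4/3) * t = 0\<close>.\<close>

lemma extremal_SAS: "diag3 (4/9) (4/9) (1/9) \<in> SAS"
proof -
  let ?\<rho> = "diag3 (4/9) (4/9) (1/9)"
  have dens: "density_operator ?\<rho>"
    using diag3_state(1)[of "4/9" "4/9" "1/9"] by (simp add: symmetric_states_def)
  have \<rho>: "?\<rho> = (4/9) *\<^sub>R mat 1 - (1/3) *\<^sub>R projector (axis 3 1)"
    by (simp add: vec_eq_iff forall_3 diag3_def projector_def mat_def axis_def complex_eq_iff)
  have "separable (sym_embed (U ** ?\<rho> ** dagger U))" if "special_unitary U" for U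
  proof (rule separable_sym_embedI)
    have U: "dagger U ** U = mat 1" "U ** dagger U = mat 1"
      using that by (auto simp: special_unitary_def)
    show "density_operator (U ** ?\<rho> ** dagger U)" by (rule density_operator_unitary[OF U(1) dens])
    let ?v = "U *v axis 3 1"
    have "U ** ?\<rho> ** dagger U = (4/9) *\<^sub>R (U ** dagger U) - (1/3) *\<^sub>R (U ** projector (axis 3 1) ** dagger U)"
      unfolding \<rho> by (simp add: vec_eq_iff matrix_matrix_mult_def sum_3 mat_def forall_3 dagger_def complex_eq_iff algebra_simps)
    then have e: "U ** ?\<rho> ** dagger U = (4/9) *\<^sub>R mat 1 - (1/3) *\<^sub>R projector ?v"
      by (simp add: U projector_unitary)
    have "norm ?v = 1" using norm_unitary[OF U(1), of "axis 3 1"] by simp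
    then show "0 \<le> sym_square a b h \<bullet> (U ** ?\<rho> ** dagger U)" for a b h
      using sym_square_le[of a b h ?v] unfolding e by (simp add: inner_diff_right sym_square_inner_mat)
  qed
  then show ?thesis using dens by (simp add: SAS_def symmetric_states_def)
qed

text \<open>This is the expectation of the partial transpose in \<open>x |00> + y |11>\<close>. It
  is linear in the state and a squared modulus on product projectors.\<close>

lemma separable_partial_transpose:
  assumes "separable \<sigma>"
  shows "0 \<le> x\<^sup>2 * Re (\<sigma> $ (1,1) $ (1,1)) + y\<^sup>2 * Re (\<sigma> $ (2,2) $ (2,2)) + 2 * x * y * Re (\<sigma> $ (1,2) $ (2,1))"
    (is "0 \<le> ?f \<sigma>")
proof -
  let ?S = "{projector (tensor u v) | u v. norm u = 1 \<and> norm v = 1}"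
  have "convex {\<sigma>. 0 \<le> ?f \<sigma>}"
  proof (rule convexI)
    fix A B :: "complex^(2 \<times> 2)^(2 \<times> 2)" and s t :: real
    assume "A \<in> {\<sigma>. 0 \<le> ?f \<sigma>}" "B \<in> {\<sigma>. 0 \<le> ?f \<sigma>}" "0 \<le> s" "0 \<le> t"
    then have "0 \<le> s * ?f A + t * ?f B" by simp
    also have "\<dots> = ?f (s *\<^sub>R A + t *\<^sub>R B)" by (simp add: algebra_simps)
    finally show "s *\<^sub>R A + t *\<^sub>R B \<in> {\<sigma>. 0 \<le> ?f \<sigma>}" by simp
  qed
  moreover have "?f (projector (tensor u v)) = (cmod (x * u $ 1 * cnj (v $ 1) + y * u $ 2 * cnj (v $ 2)))\<^sup>2" for u v
    unfolding cmod_power2 by (simp add: projector_def tensor_def) (simp add: algebra_simps power2_eq_square)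
  then have "?S \<subseteq> {\<sigma>. 0 \<le> ?f \<sigma>}" by auto
  ultimately have "convex hull ?S \<subseteq> {\<sigma>. 0 \<le> ?f \<sigma>}" by (simp add: hull_minimal)
  then show ?thesis using assms unfolding separable_def by blast
qed

text \<open>The discriminant condition for the nonnegative quadratic form \<open>q\<close>; the
  factor 4 comes from the normalisation of the middle Dicke state.\<close>

lemma separable_sym_embedD:
  assumes "separable (sym_embed \<rho>)"
  shows "(Re (\<rho> $ 2 $ 2))\<^sup>2 \<le> 4 * Re (\<rho> $ 1 $ 1) * Re (\<rho> $ 3 $ 3)"
proof -
  let ?a = "Re (\<rho> $ 1 $ 1)" and ?b = "Re (\<rho> $ 2 $ 2)" and ?c = "Re (\<rho> $ 3 $ 3)"
  have e: "sym_embed \<rho> $ (1,1) $ (1,1) = \<rho> $ 1 $ 1" "sym_embed \<rho> $ (2,2) $ (2,2) = \<rho> $ 3 $ 3"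
    "sym_embed \<rho> $ (1,2) $ (2,1) = \<rho> $ 2 $ 2 / 2"
    by (simp_all add: sym_embed_def matrix_matrix_mult_def sum_3 dagger_def dicke_def tensor_def axis_def sqrt2_mult)
  have q: "0 \<le> x\<^sup>2 * ?a + y\<^sup>2 * ?c + x * y * ?b" for x y
    using separable_partial_transpose[OF assms, of x y] by (simp add: e)
  have "?c \<ge> 0" using q[of 0 1] by simp
  show ?thesis
  proof (cases "?c = 0")
    case True
    \<comment> \<open>With \<open>?c = 0\<close> the chosen point reduces the form to
      \<open>- ?b\<^sup>2\<close>.\<close>
    have "0 \<le> - ?b\<^sup>2" using q[of ?b "- (?a + 1)"] by (simp add: True power2_eq_square algebra_simps)
    then show ?thesis by (simp add: True)
  next
    case False
    have "0 \<le> ?c * (4 * ?a * ?c - ?b\<^sup>2)"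
      using q[of "2 * ?c" "- ?b"] by (simp add: power2_eq_square algebra_simps)
    then show ?thesis using False \<open>?c \<ge> 0\<close> by (simp add: zero_le_mult_iff)
  qed
qed

text \<open>For small \<open>x\<close> the ordering bounds the purity by its value at
  \<open>(x, x, 1 - 2 * x)\<close>; for large \<open>x\<close> the last hypothesis bounds
  \<open>y * z\<close> from below. Both bounds equal \<open>11/27\<close> at \<open>x = 4/9\<close>,
  where the regimes meet.\<close>

lemma purity_bound:
  fixes x y z :: real
  assumes "z \<le> y" "y \<le> x" "0 \<le> z" "x + y + z = 1" "x\<^sup>2 \<le> 4 * y * z"
  shows "x\<^sup>2 + y\<^sup>2 + z\<^sup>2 \<le> 11 / 27"
proof (cases "x \<le> 4 / 9")
  case True
  \<comment> \<open>The largest entry is at least the mean, hence above the root \<open>2/9\<close>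
    of the quadratic below.\<close>
  have "1 / 3 \<le> x" using assms by linarith
  have z: "z = 1 - x - y" using assms(4) by simp
  have "x\<^sup>2 + y\<^sup>2 + z\<^sup>2 = x\<^sup>2 + x\<^sup>2 + (1 - 2 * x)\<^sup>2 - 2 * ((x - y) * (x - z))"
    unfolding z by algebra
  also have "\<dots> \<le> x\<^sup>2 + x\<^sup>2 + (1 - 2 * x)\<^sup>2" using assms by simp
  also have "\<dots> = 11 / 27 - 6 * ((4 / 9 - x) * (x - 2 / 9))"
    by (simp add: field_simps power2_eq_square)
  also have "\<dots> \<le> 11 / 27" using True \<open>1 / 3 \<le> x\<close> by simp
  finally show ?thesis .
next
  case False
  \<comment> \<open>The inequality of means gives \<open>x \<le> y + z\<close>, so \<open>x\<close>
    stays below the root \<open>8/9\<close>.\<close>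
  have "4 * y * z = (y + z)\<^sup>2 - (y - z)\<^sup>2" by algebra
  then have "x\<^sup>2 \<le> (y + z)\<^sup>2" using assms(5) by (smt (verit) zero_le_power2)
  then have "x \<le> y + z" by (rule power2_le_imp_le) (use assms in simp)
  then have x: "x \<le> 1 / 2" using assms by linarith
  have "y = 1 - x - z" using assms(4) by simp
  then have "x\<^sup>2 + y\<^sup>2 + z\<^sup>2 = x\<^sup>2 + (1 - x)\<^sup>2 - 2 * y * z" by algebra
  also have "\<dots> \<le> x\<^sup>2 + (1 - x)\<^sup>2 - x\<^sup>2 / 2" using assms by simp
  also have "\<dots> = 11 / 27 - 3 / 2 * ((x - 4 / 9) * (8 / 9 - x))"
    by (simp add: field_simps power2_eq_square)
  also have "\<dots> \<le> 11 / 27" using False x by simp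
  finally show ?thesis .
qed

text \<open>Absolute separability allows passing to the ordered eigenbasis, and purity is unitarily
  invariant.\<close>

lemma SAS_purity:
  assumes "\<rho> \<in> SAS"
  shows "Re (trace (\<rho> ** \<rho>)) \<le> 11 / 27"
proof -
  have dens: "density_operator \<rho>" using assms by (simp add: SAS_def symmetric_states_def)
  then have herm: "dagger \<rho> = \<rho>" by (simp add: density_operator_def)
  obtain U D where U: "special_unitary U" and D: "D = U ** \<rho> ** dagger U"
    and off: "\<And>i j. i \<noteq> j \<Longrightarrow> D $ i $ j = 0"
    and ord: "Re (D $ 3 $ 3) \<le> Re (D $ 1 $ 1)" "Re (D $ 1 $ 1) \<le> Re (D $ 2 $ 2)"
    using hermitian_diagonalization[OF herm] by metis
  have UU: "dagger U ** U = mat 1" using U by (simp add: special_unitary_def)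
  have densD: "density_operator D" unfolding D by (rule density_operator_unitary[OF UU dens])
  then have hermD: "dagger D = D" by (simp add: density_operator_def)
  have im: "Im (D $ i $ i) = 0" for i by (rule hermitian_entries(2)[OF hermD])
  have "separable (sym_embed D)" using assms U by (simp add: SAS_def D)
  then have sep: "(Re (D $ 2 $ 2))\<^sup>2 \<le> 4 * Re (D $ 1 $ 1) * Re (D $ 3 $ 3)" by (rule separable_sym_embedD)
  have "Re (cinner (axis 3 1) (D *v axis 3 1)) = Re (D $ 3 $ 3)"
    by (simp add: cinner_def sum_3 axis_def matrix_vector_mult_def)
  then have pos: "0 \<le> Re (D $ 3 $ 3)" using densD by (metis density_operator_def)
  have "Re (trace D) = 1" using densD by (simp add: density_operator_def)
  then have sum: "Re (D $ 2 $ 2) + Re (D $ 1 $ 1) + Re (D $ 3 $ 3) = 1" by (simp add: trace_def sum_3)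
  have "Re (trace (D ** D)) = (Re (D $ 2 $ 2))\<^sup>2 + (Re (D $ 1 $ 1))\<^sup>2 + (Re (D $ 3 $ 3))\<^sup>2"
    by (simp add: trace_def sum_3 matrix_matrix_mult_def off im power2_eq_square)
  also have "\<dots> \<le> 11 / 27" using ord pos sum sep by (rule purity_bound)
  finally show ?thesis unfolding D trace_square_unitary[OF UU] .
qed

lemma SAS_separable:
  assumes "\<rho> \<in> SAS" shows "separable (sym_embed \<rho>)"
proof -
  have 1: "dagger (mat 1 :: complex^3^3) = mat 1" by (simp add: dagger_def mat_def vec_eq_iff)
  then have "special_unitary (mat 1 :: complex^3^3)" by (simp add: special_unitary_def det_I)
  with assms have "separable (sym_embed (mat 1 ** \<rho> ** dagger (mat 1)))" unfolding SAS_def by blast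
  then show ?thesis by (simp add: 1)
qed

section \<open>Containment and optimality of the two balls\<close>

lemma r_SAS: "is_r_SAS (1 / (2 * sqrt 6))"
  unfolding is_r_SAS_def
proof (intro conjI allI impI)
  show "state_ball (1 / (2 * sqrt 6)) \<subseteq> SAS"
  proof
    fix \<rho> assume "\<rho> \<in> state_ball (1 / (2 * sqrt 6))"
    then have d: "density_operator \<rho>" and r: "hs_norm (\<rho> - \<rho>\<^sub>0) \<le> 1 / (2 * sqrt 6)"
      by (auto simp: state_ball_def symmetric_states_def)
    have "separable (sym_embed (U ** \<rho> ** dagger U))" if "special_unitary U" for U
    proof (rule separable_in_ball)
      have U: "dagger U ** U = mat 1" using that by (simp add: special_unitary_def)
      show "density_operator (U ** \<rho> ** dagger U)" by (rule density_operator_unitary[OF U d])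
      show "norm (U ** \<rho> ** dagger U - \<rho>\<^sub>0) \<le> 1 / (2 * sqrt 6)"
        using r hs_norm_unitary[OF U d] by (simp add: hs_norm_eq_norm)
    qed
    then show "\<rho> \<in> SAS" using d by (simp add: SAS_def symmetric_states_def)
  qed
  fix s :: real
  assume s: "0 \<le> s" "state_ball s \<subseteq> SAS"
  \<comment> \<open>The state below raises the middle eigenvalue and lies at distance
    \<open>sqrt 6 * t\<close>. The cap \<open>1/3\<close> keeps it positive; separability forces
    \<open>t \<le> 1/12\<close>, so the cap is not attained.\<close>
  define t where "t = min (s / sqrt 6) (1 / 3)"
  have t: "0 \<le> t" "t \<le> 1 / 3" "t \<le> s / sqrt 6" using s by (auto simp: t_def min_def)
  let ?\<rho> = "diag3 (1/3 - t) (1/3 + 2 * t) (1/3 - t)"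
  have "(1/3 - t)\<^sup>2 + (1/3 + 2 * t)\<^sup>2 + (1/3 - t)\<^sup>2 - 1/3 = 6 * t\<^sup>2"
    by (simp add: field_simps power2_eq_square)
  then have "hs_norm (?\<rho> - \<rho>\<^sub>0) = sqrt 6 * t"
    using t by (simp add: diag3_state(2) real_sqrt_mult)
  also have "\<dots> \<le> s" using t(3) by (simp add: field_simps)
  finally have "?\<rho> \<in> state_ball s"
    using t diag3_state(1)[of "1/3 - t" "1/3 + 2 * t" "1/3 - t"] by (simp add: state_ball_def)
  with s(2) have "separable (sym_embed ?\<rho>)" by (blast intro: SAS_separable)
  from separable_sym_embedD[OF this] have "(1/3 + 2 * t)\<^sup>2 \<le> (2 * (1/3 - t))\<^sup>2"
    by (simp add: diag3_def power2_eq_square algebra_simps)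
  then have "1/3 + 2 * t \<le> 2 * (1/3 - t)" by (rule power2_le_imp_le) (use t in simp)
  then have "s / sqrt 6 \<le> 1 / 12" unfolding t_def by (auto simp: min_def split: if_splits)
  then have "s \<le> sqrt 6 / 12" by (simp add: field_simps)
  also have "sqrt 6 / 12 = 1 / (2 * sqrt 6)" by (simp add: field_simps)
  finally show "s \<le> 1 / (2 * sqrt 6)" .
qed simp

lemma R_SAS: "is_R_SAS (2 / (3 * sqrt 6))"
  unfolding is_R_SAS_def
proof (intro conjI allI impI)
  \<comment> \<open>The number \<open>2/27\<close> is \<open>11/27 - 1/3\<close>, the largest excess
    of purity.\<close>
  have sq: "sqrt (2 / 27) = 2 / (3 * sqrt 6)"
    by (rule real_sqrt_unique) (simp_all add: power_divide power_mult_distrib)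
  show "SAS \<subseteq> state_ball (2 / (3 * sqrt 6))"
  proof
    fix \<rho> assume \<rho>: "\<rho> \<in> SAS"
    then have s: "\<rho> \<in> symmetric_states" by (simp add: SAS_def)
    have "hs_norm (\<rho> - \<rho>\<^sub>0) \<le> sqrt (2 / 27)"
      using SAS_purity[OF \<rho>] by (simp add: hs_norm_purity[OF s])
    then show "\<rho> \<in> state_ball (2 / (3 * sqrt 6))" using s by (simp add: state_ball_def sq)
  qed
  fix s :: real
  assume "SAS \<subseteq> state_ball s"
  then have "hs_norm (diag3 (4/9) (4/9) (1/9) - \<rho>\<^sub>0) \<le> s"
    using extremal_SAS by (auto simp: state_ball_def)
  moreover have "hs_norm (diag3 (4/9) (4/9) (1/9) - \<rho>\<^sub>0) = sqrt (2 / 27)"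
    by (simp add: diag3_state(2) power2_eq_square)
  ultimately show "2 / (3 * sqrt 6) \<le> s" by (simp add: sq)
qed simp

theorem mainTheorem4:
  shows "is_r_SAS (1 / (2 * sqrt 6)) \<and> is_R_SAS (2 / (3 * sqrt 6))"
  using r_SAS R_SAS by blast

end
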